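(* Let $f:[0,\infty)\to[0,\infty)$ be an increasing measurable function with $\mathrm{SINT}\, f(x)\,dx<\infty$. Then $$\mathrm{SINT}\,\exp\left(\frac{1}{x}\int_0^x \ln f(t)\,dt\right)dx\;\le\;\mathrm{SINT}\, f(x)\,dx ,$$ where the inner integral $\int_0^x \ln f(t)\,dt$ is the ordinary (classical) integral.
   Context: Let $\mu$ be Lebesgue measure on $[0,\infty)$. For a measurable function $g:[0,\infty)\to[0,\infty)$ and a measurable set $A\subseteq[0,\infty)$, the Sugeno integral of $g$ on $A$ is $\sup_{\alpha\ge 0}\min\{\alpha,\ \mu(A\cap G_\alpha)\}\in[0,\infty]$, where $G_\alpha=\{x: g(x)\ge\alpha\}$ for $\alpha>0$ and $G_0=\overline{\{x: g(x)>0\}}$ (the term $\alpha=0$ contributes $0$). The notation $\mathrm{SINT}\, g(x)\,dx$ denotes the Sugeno integral of $g$ on $A=[0,\infty)$ with respect to Lebesgue measure. Conventions: $\ln 0=-\infty$ and $\exp(-\infty)=0$, and $\int_0^x\ln f(t)\,dt$ is allowed to take the value $-\infty$. The integrand on the left-hand side is considered for $x>0$; its value at the single point $x=0$ is irrelevant since $\mu(\{0\})=0$. *)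

theory Defs
  imports "HOL-Analysis.Analysis"
begin

text \<open>
  Integrands take values in \<^typ>\<open>ennreal\<close> rather than in the nonnegative reals, so that
  exponentials of extended reals need no default value at infinity; only the restriction of
  \<open>g\<close> to the half-line \<open>{0..}\<close> matters.
\<close>

definition sugeno_level_set :: "(real \<Rightarrow> ennreal) \<Rightarrow> real \<Rightarrow> real set" where
  "sugeno_level_set g \<alpha> =
     (if \<alpha> = 0 then closure {x \<in> {0..}. g x > 0} else {x \<in> {0..}. g x \<ge> ennreal \<alpha>})"

definition sugeno_integral :: "real set \<Rightarrow> (real \<Rightarrow> ennreal) \<Rightarrow> ennreal" where
  "sugeno_integral A g =
     (SUP \<alpha>\<in>{0..}. min (ennreal \<alpha>) (emeasure (lebesgue_on {0..}) (A \<inter> sugeno_level_set g \<alpha>)))"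

definition ln_ext :: "real \<Rightarrow> ereal" where
  "ln_ext x = (if x = 0 then -\<infinity> else ereal (ln x))"

definition exp_ext :: "ereal \<Rightarrow> ennreal" where
  "exp_ext y = (case y of ereal r \<Rightarrow> ennreal (exp r) | PInfty \<Rightarrow> \<infinity> | MInfty \<Rightarrow> 0)"

text \<open>
  The Lebesgue integral of an extended-real function, as the integral of the positive part minus
  that of the negative part; \<^const>\<open>e2ennreal\<close> sends negative numbers to \<open>0\<close>.  The value is
  meaningful whenever one of the two parts is finite.  For the logarithm of a nondecreasing
  nonnegative function on a compact interval the positive part is always finite, so that the
  integral exists with a value below \<open>\<infinity>\<close>.
\<close>

definition ext_lebesgue_integral :: "'a measure \<Rightarrow> ('a \<Rightarrow> ereal) \<Rightarrow> ereal" where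
  "ext_lebesgue_integral M h =
     enn2ereal (\<integral>\<^sup>+ t. e2ennreal (h t) \<partial>M) - enn2ereal (\<integral>\<^sup>+ t. e2ennreal (- h t) \<partial>M)"

end

theory Submission
  imports Defs
begin

text \<open>
  As \<open>f\<close> is nondecreasing, the mean of \<open>ln f\<close> over \<open>[0, x]\<close> is at most \<open>ln (f x)\<close>, so the
  geometric mean is dominated by \<open>f\<close> pointwise on \<open>(0, \<infinity>)\<close>. The Sugeno integral is monotone in
  the integrand, and it ignores the point \<open>0\<close>, where the division by zero gives the left-hand
  integrand the value \<open>1\<close>.
\<close>

text \<open>A larger integrand raises the positive part and lowers the negative part. The
  nonnegative integral is monotone for arbitrary functions, and subtraction on \<open>ereal\<close>
  respects these bounds even at \<open>\<infinity> - \<infinity>\<close>, whose value is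
  \<open>\<infinity>\<close>.\<close>

lemma ext_lebesgue_integral_mono:
  assumes "\<And>t. t \<in> space M \<Longrightarrow> g t \<le> h t"
  shows "ext_lebesgue_integral M g \<le> ext_lebesgue_integral M h"
  unfolding ext_lebesgue_integral_def
  by (intro ereal_minus_mono)
    (auto simp: assms less_eq_ennreal.rep_eq[symmetric] intro!: nn_integral_mono e2ennreal_mono)

text \<open>Here \<open>c\<close> ranges over all of \<open>ereal\<close> because it will be
  \<open>ln_ext (f x)\<close>, which is \<open>-\<infinity>\<close> where
  \<open>f x = 0\<close>.\<close>

lemma ext_lebesgue_integral_const:
  assumes "emeasure M (space M) = ennreal m" and "m > 0"
  shows "ext_lebesgue_integral M (\<lambda>_. c) = ereal m * c"
proof (cases c)
  case (real r)
  \<comment> \<open>Taken at \<open>s = r\<close> and \<open>s = - r\<close>, this evaluates the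
    positive and the negative part; \<open>ennreal\<close> truncates negative reals to 0.\<close>
  have "enn2ereal (ennreal s * ennreal m) = ereal (max 0 s * m)" for s
  proof (cases "s \<ge> 0")
    case True
    then show ?thesis
      using \<open>m > 0\<close> by (simp add: ennreal_mult[symmetric] enn2ereal_ennreal)
  qed (simp add: ennreal_neg zero_ennreal.rep_eq zero_ereal_def[symmetric])
  moreover have "max 0 r * m - max 0 (- r) * m = m * r"
    by (simp add: max_def)
  ultimately show ?thesis
    using assms real by (simp add: ext_lebesgue_integral_def)
next
  case PInf
  then show ?thesis
    using assms by (simp add: ext_lebesgue_integral_def ennreal_top_mult e2ennreal_neg zero_ennreal.rep_eq)
next
  case MInf
  then show ?thesis
    using assms by (simp add: ext_lebesgue_integral_def ennreal_top_mult e2ennreal_neg zero_ennreal.rep_eq)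
qed

lemma exp_ext_mono: "a \<le> b \<Longrightarrow> exp_ext a \<le> exp_ext b"
  by (cases a; cases b) (auto simp: exp_ext_def ennreal_leI)

lemma exp_ext_ln_ext: "y \<ge> 0 \<Longrightarrow> exp_ext (ln_ext y) = ennreal y"
  by (auto simp: exp_ext_def ln_ext_def)

lemma ln_ext_mono: "0 \<le> y \<Longrightarrow> y \<le> z \<Longrightarrow> ln_ext y \<le> ln_ext z"
  by (auto simp: ln_ext_def)

lemma exp_mean_ln_le:
  fixes f :: "real \<Rightarrow> real"
  assumes nonneg: "\<And>t. t \<ge> 0 \<Longrightarrow> f t \<ge> 0" and incr: "mono_on {0..} f" and "x > 0"
  shows "exp_ext (ereal (1 / x) * ext_lebesgue_integral (lebesgue_on {0..x}) (\<lambda>t. ln_ext (f t)))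
           \<le> ennreal (f x)"
proof -
  have "emeasure (lebesgue_on {0..x}) (space (lebesgue_on {0..x})) = ennreal x"
    using \<open>x > 0\<close> by (simp add: emeasure_restrict_space space_restrict_space)
  then have const: "ext_lebesgue_integral (lebesgue_on {0..x}) (\<lambda>_. ln_ext (f x)) = ereal x * ln_ext (f x)"
    using \<open>x > 0\<close> by (rule ext_lebesgue_integral_const)
  have "ext_lebesgue_integral (lebesgue_on {0..x}) (\<lambda>t. ln_ext (f t))
      \<le> ext_lebesgue_integral (lebesgue_on {0..x}) (\<lambda>_. ln_ext (f x))"
    using nonneg mono_onD[OF incr] by (intro ext_lebesgue_integral_mono ln_ext_mono) auto
  then have "ereal (1 / x) * ext_lebesgue_integral (lebesgue_on {0..x}) (\<lambda>t. ln_ext (f t))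
      \<le> ereal (1 / x) * (ereal x * ln_ext (f x))"
    unfolding const using \<open>x > 0\<close> by (intro ereal_mult_left_mono) auto
  \<comment> \<open>Reassociating turns the finite factors into 1 first, so the cancellation also
    covers \<open>ln_ext (f x) = -\<infinity>\<close>.\<close>
  also have "\<dots> = ln_ext (f x)"
    using \<open>x > 0\<close> by (simp add: mult.assoc[symmetric] one_ereal_def[symmetric])
  finally show ?thesis
    using exp_ext_mono exp_ext_ln_ext nonneg \<open>x > 0\<close> by (metis less_imp_le)
qed

text \<open>
  Only \<open>h\<close> has to be measurable: \<^const>\<open>emeasure\<close> vanishes on nonmeasurable sets.
\<close>

lemma sugeno_integral_mono_off_zero:
  assumes A: "A \<in> sets (lebesgue_on {0..})"
    and meas: "h \<in> borel_measurable (lebesgue_on {0..})"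
    and le: "\<And>x. x > 0 \<Longrightarrow> g x \<le> h x"
  shows "sugeno_integral A g \<le> sugeno_integral A h"
  unfolding sugeno_integral_def
proof (intro SUP_mono bexI)
  let ?M = "lebesgue_on {0::real..}"
  fix \<alpha> :: real assume "\<alpha> \<in> {0..}"
  show "min (ennreal \<alpha>) (emeasure ?M (A \<inter> sugeno_level_set g \<alpha>))
      \<le> min (ennreal \<alpha>) (emeasure ?M (A \<inter> sugeno_level_set h \<alpha>))"
  \<comment> \<open>At \<alpha> = 0 both minima are 0, so the closures in the level sets never have
    to be compared.\<close>
  proof (cases "\<alpha> = 0")
    case False
    have "{x \<in> space ?M. ennreal \<alpha> \<le> h x} \<in> sets ?M"
      using meas by measurable
    then have H: "A \<inter> sugeno_level_set h \<alpha> \<in> sets ?M"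
      using A False by (auto simp: sugeno_level_set_def)
    \<comment> \<open>The point 0 may lie in the level set of \<open>g\<close> but not in that of
      \<open>h\<close>; adjoining it restores the inclusion at no cost in measure.\<close>
    have Z: "{0} \<in> null_sets ?M"
      by (auto simp: null_sets_restrict_space)
    have "A \<inter> sugeno_level_set g \<alpha> \<subseteq> A \<inter> sugeno_level_set h \<alpha> \<union> {0}"
    proof
      fix x assume "x \<in> A \<inter> sugeno_level_set g \<alpha>"
      then show "x \<in> A \<inter> sugeno_level_set h \<alpha> \<union> {0}"
        using False le[of x] by (cases "x = 0") (auto simp: sugeno_level_set_def)
    qed
    then have "emeasure ?M (A \<inter> sugeno_level_set g \<alpha>)
        \<le> emeasure ?M (A \<inter> sugeno_level_set h \<alpha> \<union> {0})"
      using H null_setsD2[OF Z] by (intro emeasure_mono sets.Un)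
    also have "\<dots> = emeasure ?M (A \<inter> sugeno_level_set h \<alpha>)"
      using H Z by (rule emeasure_Un_null_set)
    finally show ?thesis
      by (rule min.mono[OF order_refl])
  qed simp
qed

theorem theorem3p1:
  fixes f :: "real \<Rightarrow> real"
  assumes nonneg: "\<And>x. x \<ge> 0 \<Longrightarrow> f x \<ge> 0"
    and incr: "mono_on {0..} f"
    and meas: "f \<in> borel_measurable (lebesgue_on {0..})"
    and fin: "sugeno_integral {0..} (\<lambda>x. ennreal (f x)) < \<infinity>"
  shows "sugeno_integral {0..}
           (\<lambda>x. exp_ext (ereal (1 / x) * ext_lebesgue_integral (lebesgue_on {0..x}) (\<lambda>t. ln_ext (f t))))
         \<le> sugeno_integral {0..} (\<lambda>x. ennreal (f x))"
proof (rule sugeno_integral_mono_off_zero)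
  show "{0..} \<in> sets (lebesgue_on {0::real..})"
    by (simp add: sets_restrict_space_iff)
  show "(\<lambda>x. ennreal (f x)) \<in> borel_measurable (lebesgue_on {0..})"
    using meas by measurable
qed (rule exp_mean_ln_le[OF nonneg incr])

end
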